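(* Let $\gamma=\alpha+\beta=1$ with $\alpha,\beta\ge0$ and $\alpha\beta>0$. Let $X_j^n$ be the forest-fire random field with parameters $\alpha,\beta,\gamma$, and let $Y_n=\sum_{j=0}^n X_j^n$ for $n\ge0$. Then $Y_n\to0$ almost surely as $n\to\infty$.
   Context: Forest-fire random field with parameters $\alpha,\beta,\gamma$, where $0\le\alpha,\beta\le\gamma\le1$: $\mathbb{N}=\{0,1,2,\ldots\}$. A family of $\{0,1\}$-valued random variables $X(j,k)$, $j,k\in\mathbb{N}$, is given on a probability space; write $X_j^n=X(j,n-j)$ for $0\le j\le n$. Boundary conditions: $X(0,0)=1$ and $X(j,-1)=X(-1,k)=0$ for all $j,k\in\mathbb{N}$, i.e. $X_0^0=1$ and $X_{-1}^n=X_{n+1}^n=0$ for all $n\ge0$. Let $\mathcal{F}_n=\sigma(X_j^m:\ 0\le j\le m\le n)$. The law of the field is defined inductively: for every $n\ge0$, given $\mathcal{F}_n$, the variables $X_0^{n+1},\ldots,X_{n+1}^{n+1}$ are conditionally independent, and for each $0\le j\le n+1$ the conditional law of $X_j^{n+1}$ given $\mathcal{F}_n$ depends only on $(X_{j-1}^n,X_j^n)$: the conditional probability that $X_j^{n+1}=1$ equals $0$ if $(X_{j-1}^n,X_j^n)=(0,0)$, equals $\alpha$ if it is $(1,0)$, equals $\beta$ if it is $(0,1)$, and equals $\gamma$ if it is $(1,1)$. *)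

theory Defs
  imports "HOL-Probability.Probability"
begin

text \<open>Conditional probability of an event given a sub-sigma-algebra, as a random variable
  (determined up to null sets).\<close>

definition sigma_cond_prob :: "'a measure \<Rightarrow> 'a measure \<Rightarrow> 'a set \<Rightarrow> 'a \<Rightarrow> real" where
  "sigma_cond_prob M F A = real_cond_exp M F (indicator A)"

definition cond_indep_vars ::
  "'a measure \<Rightarrow> 'a measure \<Rightarrow> ('i \<Rightarrow> 'b measure) \<Rightarrow> ('i \<Rightarrow> 'a \<Rightarrow> 'b) \<Rightarrow> 'i set \<Rightarrow> bool" where
  "cond_indep_vars M F N Z I \<longleftrightarrow>
     (\<forall>i\<in>I. Z i \<in> measurable M (N i)) \<and>
     (\<forall>J A. J \<subseteq> I \<longrightarrow> finite J \<longrightarrow> (\<forall>i\<in>J. A i \<in> sets (N i)) \<longrightarrow>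
        (AE \<omega> in M. sigma_cond_prob M F {\<omega>\<in>space M. \<forall>i\<in>J. Z i \<omega> \<in> A i} \<omega> =
           (\<Prod>i\<in>J. sigma_cond_prob M F {\<omega>\<in>space M. Z i \<omega> \<in> A i} \<omega>)))"

text \<open>\<^term>\<open>ff_row X n j\<close> is $X_j^n = X(j, n-j)$. The index \<open>j\<close> is an integer because the
  boundary values $X_{-1}^n = X_{n+1}^n = 0$ are needed.\<close>

definition ff_row :: "(nat \<Rightarrow> nat \<Rightarrow> 'a \<Rightarrow> nat) \<Rightarrow> nat \<Rightarrow> int \<Rightarrow> 'a \<Rightarrow> nat" where
  "ff_row X n j \<omega> = (if 0 \<le> j \<and> j \<le> int n then X (nat j) (n - nat j) \<omega> else 0)"

definition ff_sigma :: "'a measure \<Rightarrow> (nat \<Rightarrow> nat \<Rightarrow> 'a \<Rightarrow> nat) \<Rightarrow> nat \<Rightarrow> 'a measure" where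
  "ff_sigma M X n = sigma (space M)
     {{\<omega>\<in>space M. ff_row X m (int j) \<omega> \<in> B} | j m B. j \<le> m \<and> m \<le> n \<and> B \<subseteq> {0, 1}}"

definition ff_prob :: "real \<Rightarrow> real \<Rightarrow> real \<Rightarrow> nat \<Rightarrow> nat \<Rightarrow> real" where
  "ff_prob \<alpha> \<beta> \<gamma> x y =
     (if x = 1 \<and> y = 1 then \<gamma> else if x = 1 then \<alpha> else if y = 1 then \<beta> else 0)"

locale forest_fire_field = prob_space M
  for M :: "'a measure" and X :: "nat \<Rightarrow> nat \<Rightarrow> 'a \<Rightarrow> nat" and \<alpha> \<beta> \<gamma> :: real +
  assumes params: "0 \<le> \<alpha>" "0 \<le> \<beta>" "\<alpha> \<le> \<gamma>" "\<beta> \<le> \<gamma>" "\<gamma> \<le> 1"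
    and X_measurable: "\<And>j k. X j k \<in> measurable M (count_space {0, 1})"
    and X_origin: "\<And>\<omega>. \<omega> \<in> space M \<Longrightarrow> X 0 0 \<omega> = 1"
    and cond_indep: "\<And>n. cond_indep_vars M (ff_sigma M X n) (\<lambda>_. count_space {0, 1})
        (\<lambda>j. ff_row X (Suc n) (int j)) {0..n + 1}"
    and cond_law: "\<And>n j. j \<le> n + 1 \<Longrightarrow>
        AE \<omega> in M. sigma_cond_prob M (ff_sigma M X n)
            {\<omega>\<in>space M. ff_row X (Suc n) (int j) \<omega> = 1} \<omega> =
          ff_prob \<alpha> \<beta> \<gamma> (ff_row X n (int j - 1) \<omega>) (ff_row X n (int j) \<omega>)"

text \<open>\<^const>\<open>real_cond_exp\<close> is only meaningful for sub-sigma-algebras.\<close>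

lemma (in forest_fire_field) subalgebra_ff_sigma: "subalgebra M (ff_sigma M X n)"
proof -
  have "{\<omega>\<in>space M. ff_row X m (int j) \<omega> \<in> B} \<in> sets M"
    if "j \<le> m" "B \<subseteq> {0, 1}" for j m B
  proof -
    have "X j (m - j) -` B \<inter> space M \<in> sets M"
      using that(2) by (intro measurable_sets[OF X_measurable]) auto
    also have "X j (m - j) -` B \<inter> space M = {\<omega>\<in>space M. ff_row X m (int j) \<omega> \<in> B}"
      using that(1) by (auto simp: ff_row_def)
    finally show ?thesis .
  qed
  then have "sigma_sets (space M)
      {{\<omega>\<in>space M. ff_row X m (int j) \<omega> \<in> B} | j m B. j \<le> m \<and> m \<le> n \<and> B \<subseteq> {0, 1}} \<subseteq> sets M"
    by (intro sets.sigma_sets_subset) auto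
  moreover have "{{\<omega>\<in>space M. ff_row X m (int j) \<omega> \<in> B} | j m B. j \<le> m \<and> m \<le> n \<and> B \<subseteq> {0, 1}}
      \<subseteq> Pow (space M)"
    by auto
  ultimately show ?thesis
    unfolding subalgebra_def ff_sigma_def by (simp add: space_measure_of_conv sets_measure_of)
qed

definition ff_row_sum :: "(nat \<Rightarrow> nat \<Rightarrow> 'a \<Rightarrow> nat) \<Rightarrow> nat \<Rightarrow> 'a \<Rightarrow> nat" where
  "ff_row_sum X n \<omega> = (\<Sum>j=0..n. ff_row X n (int j) \<omega>)"

end

theory Submission
  imports Defs
begin

text \<open>For \<open>\<gamma> = \<alpha> + \<beta> = 1\<close> the occupation probability of a site is
  \<open>\<alpha> X\<^sub>j\<^sub>-\<^sub>1 + \<beta> X\<^sub>j\<close>. Sites seeing only a left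
  neighbour and sites seeing only a right neighbour are equally numerous, and
  \<open>(\<beta> + \<alpha> r) (\<alpha> + \<beta> r) = r + \<alpha> \<beta> (1 - r)\<^sup>2\<close>. Hence for \<open>0 < r < 1\<close>, with
  \<open>\<delta> = \<alpha> \<beta> (1 - r)\<^sup>2\<close>,
  \<open>E r^Y\<^sub>n\<^sub>+\<^sub>1 \<ge> E r^Y\<^sub>n + \<delta> (E r^Y\<^sub>n - P(Y\<^sub>n = 0))\<close>.
  So \<open>E r^Y\<^sub>n\<close> is bounded and increasing, which forces \<open>E r^Y\<^sub>n - P(Y\<^sub>n = 0) \<longlonglongrightarrow> 0\<close>;
  as \<open>E r^Y\<^sub>n \<ge> r\<close>, letting \<open>r\<close> tend to \<open>1\<close> gives \<open>P(Y\<^sub>n = 0) \<longlonglongrightarrow> 1\<close>.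
  The state \<open>0\<close> is absorbing, so this is almost sure extinction.\<close>

section \<open>One-step inequality for a fixed occupied set\<close>

lemma card_Suc_image_Diff:
  assumes "finite S"
  shows "card (Suc ` S - S) = card (S - Suc ` S)"
proof -
  have "card (Suc ` S) = card S"
    by (simp add: card_image)
  moreover have "card (S - Suc ` S) = card S - card (S \<inter> Suc ` S)"
    using assms by (simp add: card_Diff_subset_Int)
  moreover have "card (Suc ` S - S) = card (Suc ` S) - card (S \<inter> Suc ` S)"
    using assms by (simp add: card_Diff_subset_Int Int_commute)
  ultimately show ?thesis by simp
qed

text \<open>The least element of \<open>S\<close> is not the successor of an element of
  \<open>S\<close>. A nonempty row therefore has at least one site with exactly one occupied
  parent.\<close>

lemma Diff_Suc_image_nonempty:
  assumes "S \<noteq> {}"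
  shows "S - Suc ` S \<noteq> {}"
proof -
  have "(LEAST x. x \<in> S) \<in> S"
    using assms by (metis LeastI ex_in_conv)
  moreover have "(LEAST x. x \<in> S) \<notin> Suc ` S"
    using not_less_Least[of _ "\<lambda>x. x \<in> S"] by fastforce
  ultimately show ?thesis by blast
qed

text \<open>Membership in the shifted set encodes an occupied left parent; site 0 then automatically
  has none, and no index -1 is needed.\<close>

definition site_prob :: "real \<Rightarrow> real \<Rightarrow> real \<Rightarrow> nat set \<Rightarrow> nat \<Rightarrow> real" where
  "site_prob \<alpha> \<beta> \<gamma> S j = ff_prob \<alpha> \<beta> \<gamma> (of_bool (j \<in> Suc ` S)) (of_bool (j \<in> S))"

text \<open>The product is the conditional expectation of \<open>r\<close> to the number of occupied
  sites in the next row, given the occupied set \<open>S\<close>. Sites with two occupied parents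
  give \<open>r\<close>; those with one are paired into factors \<open>r + ?d\<close>. As
  \<open>r + ?d\<close> is at least \<open>(1 + ?d) * r\<close>, one pair already yields the
  gain.\<close>

lemma prod_site_prob_ge:
  fixes \<alpha> \<beta> r :: real
  assumes ab: "\<alpha> + \<beta> = 1" "0 \<le> \<alpha>" "0 \<le> \<beta>" and r: "0 < r" "r < 1"
    and S: "S \<subseteq> {..n}" "S \<noteq> {}"
  shows "(1 + \<alpha> * \<beta> * (1 - r)\<^sup>2) * r ^ card S \<le>
    (\<Prod>j\<le>Suc n. site_prob \<alpha> \<beta> 1 S j * r + (1 - site_prob \<alpha> \<beta> 1 S j))"
proof -
  have fin: "finite S" using S(1) finite_subset by blast
  let ?U = "Suc ` S" and ?d = "\<alpha> * \<beta> * (1 - r)\<^sup>2"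
  define f where "f j = site_prob \<alpha> \<beta> 1 S j * r + (1 - site_prob \<alpha> \<beta> 1 S j)" for j
  have b: "\<beta> = 1 - \<alpha>" using ab by simp
  have d: "0 \<le> ?d" using ab by simp
  \<comment> \<open>Sites with no occupied parent stay empty and contribute the factor 1.\<close>
  have "prod f {..Suc n} = prod f ((S \<inter> ?U) \<union> (S - ?U) \<union> (?U - S))"
  proof (rule prod.mono_neutral_right)
    show "(S \<inter> ?U) \<union> (S - ?U) \<union> (?U - S) \<subseteq> {..Suc n}"
      using S(1) by force
    show "\<forall>j\<in>{..Suc n} - ((S \<inter> ?U) \<union> (S - ?U) \<union> (?U - S)). f j = 1"
    proof
      fix j assume "j \<in> {..Suc n} - ((S \<inter> ?U) \<union> (S - ?U) \<union> (?U - S))"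
      hence "j \<notin> S" "j \<notin> ?U" by blast+
      thus "f j = 1" by (simp add: f_def site_prob_def ff_prob_def)
    qed
  qed simp
  also have "\<dots> = prod f (S \<inter> ?U) * prod f (S - ?U) * prod f (?U - S)"
  proof -
    have "(S \<inter> ?U \<union> (S - ?U)) \<inter> (?U - S) = {}" "(S \<inter> ?U) \<inter> (S - ?U) = {}" by blast+
    thus ?thesis using fin by (simp add: prod.union_disjoint)
  qed
  also have "prod f (S \<inter> ?U) = (\<Prod>j\<in>S \<inter> ?U. r)"
    by (rule prod.cong) (auto simp: f_def site_prob_def ff_prob_def)
  also have "prod f (S - ?U) = (\<Prod>j\<in>S - ?U. \<alpha> + \<beta> * r)"
    by (rule prod.cong) (auto simp: f_def site_prob_def ff_prob_def b)
  also have "prod f (?U - S) = (\<Prod>j\<in>?U - S. \<beta> + \<alpha> * r)"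
    by (rule prod.cong) (auto simp: f_def site_prob_def ff_prob_def b)
  \<comment> \<open>The two one-sided sets have equal size, so their factors multiply in pairs under
    one exponent.\<close>
  also have "(\<Prod>j\<in>S \<inter> ?U. r) * (\<Prod>j\<in>S - ?U. \<alpha> + \<beta> * r) * (\<Prod>j\<in>?U - S. \<beta> + \<alpha> * r)
      = r ^ card (S \<inter> ?U) * ((\<alpha> + \<beta> * r) * (\<beta> + \<alpha> * r)) ^ card (S - ?U)"
    using card_Suc_image_Diff[OF fin] by (simp add: power_mult_distrib)
  also have "(\<alpha> + \<beta> * r) * (\<beta> + \<alpha> * r) = r + ?d"
    by (simp add: b power2_eq_square algebra_simps)
  finally have eq: "prod f {..Suc n} = r ^ card (S \<inter> ?U) * (r + ?d) ^ card (S - ?U)" .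
  \<comment> \<open>One pair is set aside for the gain \<open>1 + ?d\<close>; the other
    \<open>k\<close> pairs are merely bounded below by \<open>r\<close>.\<close>
  obtain k where k: "card (S - ?U) = Suc k"
    using Diff_Suc_image_nonempty[OF S(2)] fin
    by (metis card_eq_0_iff finite_Diff not0_implies_Suc)
  have cS: "card S = card (S \<inter> ?U) + Suc k"
    using card_Int_Diff[OF fin, of ?U] k by simp
  have "?d * r \<le> ?d * 1"
    using d r by (intro mult_left_mono) auto
  hence "(1 + ?d) * r \<le> r + ?d"
    by (simp add: distrib_right)
  moreover have "r ^ k \<le> (r + ?d) ^ k"
    using d r by (intro power_mono) auto
  ultimately have "((1 + ?d) * r) * r ^ k \<le> (r + ?d) * (r + ?d) ^ k"
    using d r by (intro mult_mono) auto
  hence "r ^ card (S \<inter> ?U) * (((1 + ?d) * r) * r ^ k) \<le>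
      r ^ card (S \<inter> ?U) * ((r + ?d) * (r + ?d) ^ k)"
    using r by (intro mult_left_mono) auto
  thus ?thesis
    unfolding f_def[symmetric] eq k cS by (simp add: power_add algebra_simps)
qed

section \<open>Rows as finite sets of occupied sites\<close>

text \<open>Recording a row as a set turns the field into a Markov chain with finitely many states
  at each time, so that conditioning on a row is a finite case distinction.\<close>

definition ff_occupied :: "(nat \<Rightarrow> nat \<Rightarrow> 'a \<Rightarrow> nat) \<Rightarrow> nat \<Rightarrow> 'a \<Rightarrow> nat set" where
  "ff_occupied X n \<omega> = {j. j \<le> n \<and> ff_row X n (int j) \<omega> = 1}"

lemma ff_occupied_subset: "ff_occupied X n \<omega> \<subseteq> {..n}"
  by (auto simp: ff_occupied_def)

context forest_fire_field
begin

lemma ff_row_binary: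
  assumes "\<omega> \<in> space M"
  shows "ff_row X n j \<omega> = 0 \<or> ff_row X n j \<omega> = 1"
  using measurable_space[OF X_measurable assms] by (auto simp: ff_row_def)

lemma ff_row_sum_eq_card:
  assumes "\<omega> \<in> space M"
  shows "ff_row_sum X n \<omega> = card (ff_occupied X n \<omega>)"
proof -
  have "ff_row_sum X n \<omega> = (\<Sum>j\<in>{0..n}. if ff_row X n (int j) \<omega> = 1 then 1 else 0)"
    unfolding ff_row_sum_def 
  proof (rule sum.cong)
    fix j show "ff_row X n (int j) \<omega> = (if ff_row X n (int j) \<omega> = 1 then 1 else 0)"
      using ff_row_binary[OF assms, of n "int j"] by auto
  qed simp
  also have "\<dots> = card {j \<in> {0..n}. ff_row X n (int j) \<omega> = 1}"
    by (simp add: sum.If_cases Int_def)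
  finally show ?thesis by (simp add: ff_occupied_def)
qed

text \<open>Sites take only the values 0 and 1, so the set of ones determines them all. The
  resulting product form is the one required by \<open>cond_indep_vars\<close>.\<close>

lemma ff_occupied_event:
  assumes "T \<subseteq> {..n}"
  shows "{\<omega> \<in> space M. ff_occupied X n \<omega> = T} =
    {\<omega> \<in> space M. \<forall>j\<in>{..n}. ff_row X n (int j) \<omega> \<in> (if j \<in> T then {1} else {0})}"
proof (intro Collect_cong conj_cong refl)
  fix \<omega> assume \<omega>: "\<omega> \<in> space M"
  have "(ff_occupied X n \<omega> = T) = (\<forall>j\<in>{..n}. ff_row X n (int j) \<omega> = 1 \<longleftrightarrow> j \<in> T)"
    unfolding ff_occupied_def using assms by blast
  also have "\<dots> = (\<forall>j\<in>{..n}. ff_row X n (int j) \<omega> \<in> (if j \<in> T then {1} else {0}))"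
  proof (rule ball_cong)
    fix j show "(ff_row X n (int j) \<omega> = 1 \<longleftrightarrow> j \<in> T) =
        (ff_row X n (int j) \<omega> \<in> (if j \<in> T then {1} else {0}))"
      using ff_row_binary[OF \<omega>, of n "int j"] by auto
  qed simp
  finally show "(ff_occupied X n \<omega> = T) =
      (\<forall>j\<in>{..n}. ff_row X n (int j) \<omega> \<in> (if j \<in> T then {1} else {0}))" .
qed

lemma ff_row_in_ff_sigma:
  assumes "j \<le> m" "m \<le> n" "B \<subseteq> {0, 1}"
  shows "{\<omega> \<in> space M. ff_row X m (int j) \<omega> \<in> B} \<in> sets (ff_sigma M X n)"
  unfolding ff_sigma_def using assms by (intro in_measure_of) blast+

lemma ff_occupied_in_ff_sigma:
  assumes "T \<subseteq> {..n}"
  shows "{\<omega> \<in> space M. ff_occupied X n \<omega> = T} \<in> sets (ff_sigma M X n)"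
proof -
  have "{\<omega> \<in> space M. ff_occupied X n \<omega> = T} =
      (\<Inter>j\<in>{..n}. {\<omega> \<in> space M. ff_row X n (int j) \<omega> \<in> (if j \<in> T then {1} else {0})})"
    unfolding ff_occupied_event[OF assms] by blast
  also have "\<dots> \<in> sets (ff_sigma M X n)"
    by (intro sets.finite_INT ff_row_in_ff_sigma) auto
  finally show ?thesis .
qed

text \<open>For \<open>T\<close> outside the range of sites the event is empty, so no side condition
  remains and the \<open>measurable\<close> method can use the fact.\<close>

lemma sets_ff_occupied [measurable]:
  "{\<omega> \<in> space M. ff_occupied X n \<omega> = T} \<in> sets M"
proof (cases "T \<subseteq> {..n}")
  case True
  thus ?thesis
    using ff_occupied_in_ff_sigma[of T n] subalgebra_ff_sigma[of n] by (auto simp: subalgebra_def)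
next
  case False
  hence "{\<omega> \<in> space M. ff_occupied X n \<omega> = T} = {}"
    using ff_occupied_subset[of X n] by auto
  thus ?thesis by (metis sets.empty_sets)
qed

lemma sigma_finite_subalgebra_ff_sigma: "sigma_finite_subalgebra M (ff_sigma M X n)"
  by (intro finite_measure_subalgebra_is_sigma_finite)
    (simp add: finite_measure_subalgebra_def finite_measure_subalgebra_axioms_def
      subalgebra_ff_sigma finite_measure_axioms)

lemma sets_ff_row:
  assumes "j \<le> n" "B \<subseteq> {0, 1}"
  shows "{\<omega> \<in> space M. ff_row X n (int j) \<omega> \<in> B} \<in> sets M"
  using ff_row_in_ff_sigma[of j n n B] subalgebra_ff_sigma[of n] assms
  by (auto simp: subalgebra_def)

section \<open>Transition probabilities\<close>

lemma cond_prob_site_one: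
  assumes "j \<le> Suc n"
  shows "AE \<omega> in M. sigma_cond_prob M (ff_sigma M X n)
      {\<omega> \<in> space M. ff_row X (Suc n) (int j) \<omega> \<in> {1}} \<omega> =
    site_prob \<alpha> \<beta> \<gamma> (ff_occupied X n \<omega>) j"
proof -
  have "ff_prob \<alpha> \<beta> \<gamma> (ff_row X n (int j - 1) \<omega>) (ff_row X n (int j) \<omega>) =
      site_prob \<alpha> \<beta> \<gamma> (ff_occupied X n \<omega>) j" if \<omega>: "\<omega> \<in> space M" for \<omega>
  proof -
    \<comment> \<open>At the right edge \<open>j = Suc n\<close> both sides are 0: the row by its
      default value, the set by its bound.\<close>
    have "ff_row X n (int j) \<omega> = of_bool (j \<in> ff_occupied X n \<omega>)"
      using ff_row_binary[OF \<omega>, of n "int j"] by (auto simp: ff_occupied_def ff_row_def)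
    moreover have "ff_row X n (int j - 1) \<omega> = of_bool (j \<in> Suc ` ff_occupied X n \<omega>)"
    proof (cases j)
      \<comment> \<open>At the left edge \<open>ff_row\<close> has its default value 0 at index -1,
        and 0 is not a successor.\<close>
      case 0
      thus ?thesis by (auto simp: ff_row_def)
    next
      case (Suc i)
      moreover have "ff_row X n (int i) \<omega> = of_bool (i \<in> ff_occupied X n \<omega>)"
        using ff_row_binary[OF \<omega>, of n "int i"] by (auto simp: ff_occupied_def ff_row_def)
      ultimately show ?thesis by (simp add: image_iff)
    qed
    ultimately show ?thesis by (simp add: site_prob_def)
  qed
  thus ?thesis
    using cond_law[of j n] assms AE_space by fastforce
qed

text \<open>Binary values make the two indicators complementary, and conditional expectation is
  linear and fixes the constant 1.\<close>

lemma cond_prob_site_zero: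
  assumes "j \<le> Suc n"
  shows "AE \<omega> in M. sigma_cond_prob M (ff_sigma M X n)
      {\<omega> \<in> space M. ff_row X (Suc n) (int j) \<omega> \<in> {0}} \<omega> =
    1 - site_prob \<alpha> \<beta> \<gamma> (ff_occupied X n \<omega>) j"
proof -
  interpret F: sigma_finite_subalgebra M "ff_sigma M X n"
    by (rule sigma_finite_subalgebra_ff_sigma)
  let ?A = "\<lambda>i. {\<omega> \<in> space M. ff_row X (Suc n) (int j) \<omega> \<in> {i}}"
  have A: "?A 0 \<in> sets M" "?A 1 \<in> sets M"
    using assms by (intro sets_ff_row; simp)+
  have "AE \<omega> in M. real_cond_exp M (ff_sigma M X n) (indicator (?A 0)) \<omega> =
      real_cond_exp M (ff_sigma M X n) (\<lambda>\<omega>. 1 - indicator (?A 1) \<omega>) \<omega>"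
  proof (intro F.real_cond_exp_cong AE_I2)
    fix \<omega> assume "\<omega> \<in> space M"
    thus "indicat_real (?A 0) \<omega> = 1 - indicator (?A 1) \<omega>"
      using ff_row_binary[of \<omega> "Suc n" "int j"] by (auto simp: indicator_def)
  qed (use A in measurable)
  moreover have "AE \<omega> in M. real_cond_exp M (ff_sigma M X n) (\<lambda>\<omega>. 1 - indicator (?A 1) \<omega>) \<omega> =
      real_cond_exp M (ff_sigma M X n) (\<lambda>\<omega>. 1) \<omega> -
      real_cond_exp M (ff_sigma M X n) (indicator (?A 1)) \<omega>"
    using A by (intro F.real_cond_exp_diff) (auto simp: emeasure_eq_measure)
  moreover have "AE \<omega> in M. real_cond_exp M (ff_sigma M X n) (\<lambda>\<omega>. 1) \<omega> = 1"
    by (intro F.real_cond_exp_F_meas) auto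
  moreover note cond_prob_site_one[OF assms]
  ultimately show ?thesis
    unfolding sigma_cond_prob_def by eventually_elim simp
qed

text \<open>Conditional independence turns the conditional probability of the next row into a
  product of site probabilities. This product is constant on the event that the current row is
  \<open>S\<close>; integrating over that event gives the joint law.\<close>

lemma transition_prob:
  assumes S: "S \<subseteq> {..n}" and T: "T \<subseteq> {..Suc n}"
  shows "prob {\<omega> \<in> space M. ff_occupied X n \<omega> = S \<and> ff_occupied X (Suc n) \<omega> = T} =
    prob {\<omega> \<in> space M. ff_occupied X n \<omega> = S} *
      ((\<Prod>j\<in>T. site_prob \<alpha> \<beta> \<gamma> S j) * (\<Prod>j\<in>{..Suc n} - T. 1 - site_prob \<alpha> \<beta> \<gamma> S j))"
proof -
  interpret F: sigma_finite_subalgebra M "ff_sigma M X n"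
    by (rule sigma_finite_subalgebra_ff_sigma)
  let ?F = "ff_sigma M X n"
  let ?ES = "{\<omega> \<in> space M. ff_occupied X n \<omega> = S}"
  let ?ET = "{\<omega> \<in> space M. ff_occupied X (Suc n) \<omega> = T}"
  let ?A = "\<lambda>j. if j \<in> T then {1::nat} else {0}"
  define q where "q S' = (\<Prod>j\<le>Suc n. if j \<in> T then site_prob \<alpha> \<beta> \<gamma> S' j
    else 1 - site_prob \<alpha> \<beta> \<gamma> S' j)" for S'
  have "AE \<omega> in M. sigma_cond_prob M ?F ?ET \<omega> =
      (\<Prod>j\<le>Suc n. sigma_cond_prob M ?F
        {\<omega> \<in> space M. ff_row X (Suc n) (int j) \<omega> \<in> ?A j} \<omega>)"
    unfolding ff_occupied_event[OF T]
    by (intro cond_indep[of n, unfolded cond_indep_vars_def, THEN conjunct2, rule_format]) auto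
  moreover have "AE \<omega> in M. \<forall>j\<in>{..Suc n}. sigma_cond_prob M ?F
        {\<omega> \<in> space M. ff_row X (Suc n) (int j) \<omega> \<in> ?A j} \<omega> =
      (if j \<in> T then site_prob \<alpha> \<beta> \<gamma> (ff_occupied X n \<omega>) j
       else 1 - site_prob \<alpha> \<beta> \<gamma> (ff_occupied X n \<omega>) j)"
  proof (intro AE_finite_allI finite_atMost)
    fix j assume "j \<in> {..Suc n}"
    thus "AE \<omega> in M. sigma_cond_prob M ?F
        {\<omega> \<in> space M. ff_row X (Suc n) (int j) \<omega> \<in> ?A j} \<omega> =
      (if j \<in> T then site_prob \<alpha> \<beta> \<gamma> (ff_occupied X n \<omega>) j
       else 1 - site_prob \<alpha> \<beta> \<gamma> (ff_occupied X n \<omega>) j)"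
      using cond_prob_site_one[of j n] cond_prob_site_zero[of j n] by (cases "j \<in> T") simp_all
  qed
  ultimately have q: "AE \<omega> in M. real_cond_exp M ?F (indicator ?ET) \<omega> = q (ff_occupied X n \<omega>)"
    unfolding sigma_cond_prob_def q_def by eventually_elim simp
  have "prob {\<omega> \<in> space M. ff_occupied X n \<omega> = S \<and> ff_occupied X (Suc n) \<omega> = T} =
      prob (?ES \<inter> ?ET)"
    by (intro arg_cong[of _ _ prob]) auto
  also have "\<dots> = (\<integral>\<omega>\<in>?ES. indicator ?ET \<omega> \<partial>M)"
    unfolding set_lebesgue_integral_def
    by (simp flip: indicator_inter_arith)
  \<comment> \<open>The event \<open>?ES\<close> lies in the conditioning sigma-algebra, so the
    indicator may be replaced by its conditional expectation.\<close>
  also have "\<dots> = (\<integral>\<omega>\<in>?ES. real_cond_exp M ?F (indicator ?ET) \<omega> \<partial>M)"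
    by (intro F.real_cond_exp_intA ff_occupied_in_ff_sigma S)
      (auto simp: emeasure_eq_measure)
  also have "\<dots> = (\<integral>\<omega>. indicator ?ES \<omega> * q S \<partial>M)"
    unfolding set_lebesgue_integral_def
  proof (rule integral_cong_AE)
    show "AE \<omega> in M. indicat_real ?ES \<omega> *\<^sub>R real_cond_exp M ?F (indicator ?ET) \<omega> =
        indicator ?ES \<omega> * q S"
      using q by eventually_elim (auto simp: indicator_def)
  qed measurable
  also have "\<dots> = prob ?ES * q S"
    by simp
  also have "q S = (\<Prod>j\<in>T. site_prob \<alpha> \<beta> \<gamma> S j) * (\<Prod>j\<in>{..Suc n} - T. 1 - site_prob \<alpha> \<beta> \<gamma> S j)"
    unfolding q_def using T by (simp add: prod.If_cases Int_absorb1 Diff_eq del: prod.atMost_Suc)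
  finally show ?thesis .
qed

section \<open>Generating function of the row sums\<close>

text \<open>The probability generating function of the row sum, as a finite sum over states so that
  the recursion needs no integrals.\<close>

definition row_pgf :: "nat \<Rightarrow> real \<Rightarrow> real" where
  "row_pgf n r = (\<Sum>S\<in>Pow {..n}. prob {\<omega> \<in> space M. ff_occupied X n \<omega> = S} * r ^ card S)"

lemma prob_eq_sum_ff_occupied:
  assumes "E \<in> sets M"
  shows "prob E = (\<Sum>S\<in>Pow {..n}. prob (E \<inter> {\<omega> \<in> space M. ff_occupied X n \<omega> = S}))"
proof -
  have "E = (\<Union>S\<in>Pow {..n}. E \<inter> {\<omega> \<in> space M. ff_occupied X n \<omega> = S})"
    using sets.sets_into_space[OF assms] ff_occupied_subset[of X n] by auto
  hence "prob E = prob (\<Union>S\<in>Pow {..n}. E \<inter> {\<omega> \<in> space M. ff_occupied X n \<omega> = S})"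
    by simp
  also have "\<dots> = (\<Sum>S\<in>Pow {..n}. prob (E \<inter> {\<omega> \<in> space M. ff_occupied X n \<omega> = S}))"
    using assms by (intro finite_measure_finite_Union) (auto simp: disjoint_family_on_def)
  finally show ?thesis .
qed

text \<open>Total probability over the current state; given that state, the sites are independent
  and each contributes its own generating function.\<close>

lemma row_pgf_Suc:
  "row_pgf (Suc n) r = (\<Sum>S\<in>Pow {..n}. prob {\<omega> \<in> space M. ff_occupied X n \<omega> = S} *
    (\<Prod>j\<le>Suc n. site_prob \<alpha> \<beta> \<gamma> S j * r + (1 - site_prob \<alpha> \<beta> \<gamma> S j)))"
proof -
  let ?\<mu> = "\<lambda>S. prob {\<omega> \<in> space M. ff_occupied X n \<omega> = S}"
  let ?K = "\<lambda>S T. (\<Prod>j\<in>T. site_prob \<alpha> \<beta> \<gamma> S j) * (\<Prod>j\<in>{..Suc n} - T. 1 - site_prob \<alpha> \<beta> \<gamma> S j)"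
  have step: "prob {\<omega> \<in> space M. ff_occupied X (Suc n) \<omega> = T} = (\<Sum>S\<in>Pow {..n}. ?\<mu> S * ?K S T)"
    if T: "T \<subseteq> {..Suc n}" for T
  proof -
    have "prob {\<omega> \<in> space M. ff_occupied X (Suc n) \<omega> = T} = (\<Sum>S\<in>Pow {..n}.
        prob {\<omega> \<in> space M. ff_occupied X n \<omega> = S \<and> ff_occupied X (Suc n) \<omega> = T})"
      by (subst prob_eq_sum_ff_occupied[of _ n])
        (auto intro!: sum.cong arg_cong[of _ _ prob])
    thus ?thesis
      using T by (simp add: transition_prob)
  qed
  have "row_pgf (Suc n) r = (\<Sum>T\<in>Pow {..Suc n}. \<Sum>S\<in>Pow {..n}. ?\<mu> S * ?K S T * r ^ card T)"
    unfolding row_pgf_def using step by (intro sum.cong) (simp_all add: sum_distrib_right)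
  also have "\<dots> = (\<Sum>S\<in>Pow {..n}. ?\<mu> S * (\<Sum>T\<in>Pow {..Suc n}. ?K S T * r ^ card T))"
    by (subst sum.swap) (simp add: sum_distrib_left mult.assoc)
  \<comment> \<open>Expanding the product over sites sums over the set \<open>T\<close> of sites
    chosen as occupied, whose factors \<open>r\<close> collect into
    \<open>r ^ card T\<close>.\<close>
  also have "(\<lambda>S. \<Sum>T\<in>Pow {..Suc n}. ?K S T * r ^ card T) =
      (\<lambda>S. \<Prod>j\<le>Suc n. site_prob \<alpha> \<beta> \<gamma> S j * r + (1 - site_prob \<alpha> \<beta> \<gamma> S j))"
    by (rule ext, subst prod_add) (auto simp: prod.distrib intro!: sum.cong)
  finally show ?thesis .
qed

lemma row_pgf_le_one:
  assumes "0 \<le> r" "r \<le> 1"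
  shows "row_pgf n r \<le> 1"
proof -
  have "row_pgf n r \<le> (\<Sum>S\<in>Pow {..n}. prob {\<omega> \<in> space M. ff_occupied X n \<omega> = S})"
    unfolding row_pgf_def using assms
    by (intro sum_mono mult_left_le power_le_one) auto
  also have "\<dots> = prob (space M)"
    by (subst (2) prob_eq_sum_ff_occupied[of _ n]) (auto intro!: sum.cong arg_cong[of _ _ prob])
  finally show ?thesis by (simp add: prob_space)
qed

lemma row_pgf_0: "row_pgf 0 r = r"
proof -
  have "ff_occupied X 0 \<omega> = {0}" if "\<omega> \<in> space M" for \<omega>
    using X_origin[OF that] by (auto simp: ff_occupied_def ff_row_def)
  hence *: "{\<omega> \<in> space M. ff_occupied X 0 \<omega> = S} = (if S = {0} then space M else {})" for S
    by auto
  have "Pow {..0::nat} = {{}, {0}}" by auto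
  thus ?thesis by (simp add: row_pgf_def * prob_space)
qed

section \<open>Absorption, drift and extinction\<close>

text \<open>After an empty row every site has probability 0 of being occupied, so each nonempty
  \<open>T\<close> has transition probability 0. There are finitely many such \<open>T\<close>,
  hence a common null set.\<close>

lemma ff_occupied_empty_absorbing:
  "AE \<omega> in M. ff_occupied X n \<omega> = {} \<longrightarrow> ff_occupied X (Suc n) \<omega> = {}"
proof -
  have "AE \<omega> in M. \<forall>T\<in>Pow {..Suc n} - {{}}. \<not> (ff_occupied X n \<omega> = {} \<and> ff_occupied X (Suc n) \<omega> = T)"
  proof (rule AE_finite_allI)
    fix T :: "nat set" assume T: "T \<in> Pow {..Suc n} - {{}}"
    then obtain j where "j \<in> T" by auto
    moreover have "finite T" using T finite_subset by blast
    moreover have "site_prob \<alpha> \<beta> \<gamma> {} j = 0" by (simp add: site_prob_def ff_prob_def)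
    ultimately have "(\<Prod>j\<in>T. site_prob \<alpha> \<beta> \<gamma> {} j) = 0" by auto
    hence "prob {\<omega> \<in> space M. ff_occupied X n \<omega> = {} \<and> ff_occupied X (Suc n) \<omega> = T} = 0"
      using T transition_prob[of "{}" n T] by simp
    moreover have "{\<omega> \<in> space M. ff_occupied X n \<omega> = {} \<and> ff_occupied X (Suc n) \<omega> = T} \<in> events"
      by measurable
    ultimately have "AE \<omega> in M. \<omega> \<notin>
        {\<omega> \<in> space M. ff_occupied X n \<omega> = {} \<and> ff_occupied X (Suc n) \<omega> = T}"
      by (simp only: prob_eq_0)
    thus "AE \<omega> in M. \<not> (ff_occupied X n \<omega> = {} \<and> ff_occupied X (Suc n) \<omega> = T)"
      using AE_space by eventually_elim blast
  qed simp
  thus ?thesis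
  proof eventually_elim
    case (elim \<omega>)
    thus ?case using ff_occupied_subset[of X "Suc n" \<omega>] by blast
  qed
qed

text \<open>The empty state keeps its contribution, its product being 1. All other states gain at
  least the factor \<open>1 + ?d\<close>, and the difference in parentheses is exactly their share
  of \<open>row_pgf n r\<close>.\<close>

lemma row_pgf_drift:
  assumes "\<alpha> + \<beta> = 1" "\<gamma> = 1" and r: "0 < r" "r < 1"
  shows "row_pgf n r + \<alpha> * \<beta> * (1 - r)\<^sup>2 *
    (row_pgf n r - prob {\<omega> \<in> space M. ff_occupied X n \<omega> = {}}) \<le> row_pgf (Suc n) r"
proof -
  let ?\<mu> = "\<lambda>S. prob {\<omega> \<in> space M. ff_occupied X n \<omega> = S}"
  let ?d = "\<alpha> * \<beta> * (1 - r)\<^sup>2"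
  let ?f = "\<lambda>S. \<Prod>j\<le>Suc n. site_prob \<alpha> \<beta> \<gamma> S j * r + (1 - site_prob \<alpha> \<beta> \<gamma> S j)"
  have split: "(\<Sum>S\<in>Pow {..n}. g S) = g {} + (\<Sum>S\<in>Pow {..n} - {{}}. g S)" for g :: "_ \<Rightarrow> real"
    by (rule sum.remove) auto
  have "row_pgf n r + ?d * (row_pgf n r - ?\<mu> {}) =
      ?\<mu> {} + (\<Sum>S\<in>Pow {..n} - {{}}. ?\<mu> S * ((1 + ?d) * r ^ card S))"
    unfolding row_pgf_def split by (simp add: sum_distrib_left sum.distrib algebra_simps)
  also have "\<dots> \<le> ?\<mu> {} + (\<Sum>S\<in>Pow {..n} - {{}}. ?\<mu> S * ?f S)"
    using prod_site_prob_ge[OF assms(1) params(1,2) r] assms(2)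
    by (intro add_left_mono sum_mono mult_left_mono) auto
  also have "?f {} = 1" by (simp add: site_prob_def ff_prob_def)
  hence "?\<mu> {} + (\<Sum>S\<in>Pow {..n} - {{}}. ?\<mu> S * ?f S) = row_pgf (Suc n) r"
    unfolding row_pgf_Suc split by simp
  finally show ?thesis .
qed

lemma prob_empty_le_row_pgf:
  assumes "0 \<le> r"
  shows "prob {\<omega> \<in> space M. ff_occupied X n \<omega> = {}} \<le> row_pgf n r"
proof -
  let ?g = "\<lambda>S. prob {\<omega> \<in> space M. ff_occupied X n \<omega> = S} * r ^ card S"
  have "?g {} \<le> row_pgf n r"
    unfolding row_pgf_def using assms by (intro member_le_sum) auto
  thus ?thesis by simp
qed

text \<open>Increasing and bounded, \<open>row_pgf n r\<close> has a limit \<open>L\<close>. The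
  drift bounds its excess over \<open>p\<close> by a multiple of increments that tend to 0, so
  \<open>r = row_pgf 0 r \<le> L \<le> p\<close>. Allowing any bound \<open>p\<close> avoids taking
  a limit of the extinction probabilities.\<close>

lemma extinction_prob_ge:
  assumes ab: "\<alpha> + \<beta> = 1" "\<gamma> = 1" "0 < \<alpha> * \<beta>" and r: "0 < r" "r < 1"
    and bound: "\<And>n. prob {\<omega> \<in> space M. ff_occupied X n \<omega> = {}} \<le> p"
  shows "r \<le> p"
proof -
  let ?d = "\<alpha> * \<beta> * (1 - r)\<^sup>2"
  let ?e = "\<lambda>n. prob {\<omega> \<in> space M. ff_occupied X n \<omega> = {}}"
  note drift = row_pgf_drift[OF ab(1,2) r]
  have d: "0 < ?d" using ab r by simp
  have mono: "incseq (\<lambda>n. row_pgf n r)"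
  proof (rule incseq_SucI)
    fix n
    have "0 \<le> ?d * (row_pgf n r - ?e n)"
      by (rule mult_nonneg_nonneg) (use d prob_empty_le_row_pgf[of r n] r in linarith)+
    thus "row_pgf n r \<le> row_pgf (Suc n) r" using drift[of n] by linarith
  qed
  have "\<forall>n. row_pgf n r \<le> 1"
    using row_pgf_le_one r by simp
  from incseq_convergent[OF mono this] obtain L where L: "(\<lambda>n. row_pgf n r) \<longlonglongrightarrow> L"
    by blast
  have "row_pgf n r - p \<le> (row_pgf (Suc n) r - row_pgf n r) / ?d" for n
  proof -
    have "row_pgf n r - ?e n \<le> (row_pgf (Suc n) r - row_pgf n r) / ?d"
      using drift[of n] d by (simp add: pos_le_divide_eq mult.commute)
    thus ?thesis using bound[of n] by linarith
  qed
  moreover have "(\<lambda>n. (row_pgf (Suc n) r - row_pgf n r) / ?d) \<longlonglongrightarrow> (L - L) / ?d"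
    by (rule tendsto_divide[OF tendsto_diff[OF LIMSEQ_Suc[OF L] L] tendsto_const]) (use d in linarith)
  moreover have "(\<lambda>n. row_pgf n r - p) \<longlonglongrightarrow> L - p"
    by (intro tendsto_diff L tendsto_const)
  ultimately have "L - p \<le> (L - L) / ?d"
    using LIMSEQ_le by blast
  moreover have "row_pgf 0 r \<le> L"
    by (rule incseq_le[OF mono L])
  ultimately show ?thesis by (simp add: row_pgf_0)
qed

text \<open>The probability of ever reaching the empty row can serve as the bound \<open>p\<close>.
  It does not depend on \<open>r\<close>, so letting \<open>r\<close> approach 1 shows that it
  equals 1.\<close>

lemma AE_extinction:
  assumes "\<alpha> + \<beta> = 1" "\<gamma> = 1" "0 < \<alpha> * \<beta>"
  shows "AE \<omega> in M. \<exists>n. ff_occupied X n \<omega> = {}"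
proof -
  let ?E = "{\<omega> \<in> space M. \<exists>n. ff_occupied X n \<omega> = {}}"
  have E: "?E \<in> sets M" by measurable
  have "prob {\<omega> \<in> space M. ff_occupied X n \<omega> = {}} \<le> prob ?E" for n
    using E by (intro finite_measure_mono) auto
  hence ge: "r \<le> prob ?E" if "0 < r" "r < 1" for r
    using extinction_prob_ge[OF assms that] by blast
  have "1 \<le> prob ?E" by (rule dense_le_bounded[OF zero_less_one ge])
  hence "prob ?E = 1" using prob_le_1[of ?E] by linarith
  from AE_prob_1[OF this] show ?thesis by eventually_elim blast
qed

end

section \<open>Convergence of the row sums\<close>

theorem theorem1:
  fixes M :: "'a measure" and X :: "nat \<Rightarrow> nat \<Rightarrow> 'a \<Rightarrow> nat" and \<alpha> \<beta> \<gamma> :: real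
  assumes "\<gamma> = \<alpha> + \<beta>" and "\<alpha> + \<beta> = 1"
    and "\<alpha> \<ge> 0" and "\<beta> \<ge> 0" and "\<alpha> * \<beta> > 0"
    and "forest_fire_field M X \<alpha> \<beta> \<gamma>"
  shows "AE \<omega> in M. (\<lambda>n. real (ff_row_sum X n \<omega>)) \<longlonglongrightarrow> 0"
proof -
  interpret forest_fire_field M X \<alpha> \<beta> \<gamma> by fact
  \<comment> \<open>There are countably many rows, so one null set serves all
    \<open>n\<close>.\<close>
  have "AE \<omega> in M. \<forall>n. ff_occupied X n \<omega> = {} \<longrightarrow> ff_occupied X (Suc n) \<omega> = {}"
    using ff_occupied_empty_absorbing by (simp add: AE_all_countable)
  moreover have "AE \<omega> in M. \<exists>n. ff_occupied X n \<omega> = {}"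
    using assms by (intro AE_extinction) auto
  ultimately show ?thesis
    using AE_space
  proof eventually_elim
    case (elim \<omega>)
    then obtain m where m: "ff_occupied X m \<omega> = {}" by blast
    \<comment> \<open>Absorption carries emptiness from row \<open>m\<close> to all later rows, so
      the row sums are eventually constant 0.\<close>
    have "ff_occupied X n \<omega> = {}" if "m \<le> n" for n
      using that by (induction rule: dec_induct) (use m elim(1) in auto)
    hence "\<forall>n\<ge>m. real (ff_row_sum X n \<omega>) = 0"
      by (simp add: ff_row_sum_eq_card[OF elim(3)])
    hence "eventually (\<lambda>n. real (ff_row_sum X n \<omega>) = 0) sequentially"
      unfolding eventually_sequentially ..
    thus ?case by (rule tendsto_eventually)
  qed
qed

end
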